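(* Let $G$ be a finite group with a finite symmetric generating set $S$ (i.e. $S=S^{-1}$), let $\mu$ be the normalized Haar (uniform) measure on $G$, let $\mathcal N=L_\infty(G,\mu)$, and let $E_{\mathrm{fix}}:\mathcal N\to\mathcal N$, $E_{\mathrm{fix}}(f)=\left(\int_G f\,d\mu\right)\mathbf 1_G$. Then there exists a Lipschitz semi-norm $|||\cdot|||_L$ on $\mathcal N$ such that $$\mathrm{Cost}_L(E_{\mathrm{fix}})=\int_G \ell_S(g)\,d\mu(g).$$
   Context: Word length: $\ell_S(g)=\min\{n\in\mathbb N: g=s_1\cdots s_n,\ s_i\in S\}$, with $\ell_S(e)=0$. A Lipschitz semi-norm on $\mathcal N$ is a semi-norm $|||\cdot|||_L:\mathcal N\to[0,\infty)$ with $|||\mathbf 1|||_L=0$ and $|||f|||_L=|||f^*|||_L$. For a normal unital completely positive map $\Phi:\mathcal N\to\mathcal N$, the transportation (Lipschitz) cost is $$\mathrm{Cost}_L(\Phi)=\sup\{\|\Phi(x)-x\|_{op}: x=x^*\in\mathcal N,\ |||x|||_L\le1\},$$ where for $\mathcal N=L_\infty(G,\mu)$ the norm $\|\cdot\|_{op}$ is the supremum norm (the operator norm of the multiplication operator on $L_2(G,\mu)$) and self-adjoint means real-valued. *)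

theory Defs
  imports "HOL-Probability.Probability" "HOL-Algebra.Generated_Groups"
begin

text \<open>
  Elements of $L_\infty(M)$ are represented by measurable, essentially bounded functions
  into \<^typ>\<open>complex\<close>; two representatives denote the same element iff they agree almost everywhere.
  Hence semi-norms on $L_\infty(M)$ have to respect almost-everywhere equality, and equations
  between elements are stated almost everywhere.
\<close>

definition Linf :: "'a measure \<Rightarrow> ('a \<Rightarrow> complex) set" where
  "Linf M = {f \<in> borel_measurable M. \<exists>C. AE x in M. cmod (f x) \<le> C}"

definition Linf_norm :: "'a measure \<Rightarrow> ('a \<Rightarrow> complex) \<Rightarrow> ereal" where
  "Linf_norm M f = esssup M (\<lambda>x. ereal (cmod (f x)))"

definition Linf_selfadjoint :: "'a measure \<Rightarrow> ('a \<Rightarrow> complex) \<Rightarrow> bool" where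
  "Linf_selfadjoint M f \<longleftrightarrow> (AE x in M. cnj (f x) = f x)"

definition lipschitz_seminorm :: "'a measure \<Rightarrow> (('a \<Rightarrow> complex) \<Rightarrow> real) \<Rightarrow> bool" where
  "lipschitz_seminorm M L \<longleftrightarrow>
     (\<forall>f\<in>Linf M. \<forall>g\<in>Linf M. (AE x in M. f x = g x) \<longrightarrow> L f = L g) \<and>
     (\<forall>f\<in>Linf M. 0 \<le> L f) \<and>
     (\<forall>c. \<forall>f\<in>Linf M. L (\<lambda>x. c * f x) = cmod c * L f) \<and>
     (\<forall>f\<in>Linf M. \<forall>g\<in>Linf M. L (\<lambda>x. f x + g x) \<le> L f + L g) \<and>
     L (\<lambda>x. 1) = 0 \<and>
     (\<forall>f\<in>Linf M. L (\<lambda>x. cnj (f x)) = L f)"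

text \<open>The cost is a supremum that may be infinite, so it takes values in \<^typ>\<open>ereal\<close>.\<close>

definition lipschitz_cost ::
  "'a measure \<Rightarrow> (('a \<Rightarrow> complex) \<Rightarrow> real) \<Rightarrow> (('a \<Rightarrow> complex) \<Rightarrow> ('a \<Rightarrow> complex)) \<Rightarrow> ereal" where
  "lipschitz_cost M L \<Phi> =
     (SUP f \<in> {f \<in> Linf M. Linf_selfadjoint M f \<and> L f \<le> 1}. Linf_norm M (\<lambda>x. \<Phi> f x - f x))"

definition E_fix :: "'a measure \<Rightarrow> ('a \<Rightarrow> complex) \<Rightarrow> ('a \<Rightarrow> complex)" where
  "E_fix M f = (\<lambda>x. integral\<^sup>L M f)"

text \<open>The empty word is allowed, so the identity has length 0. The value is meaningful only for
  elements that are products of elements of \<open>S\<close>.\<close>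

definition word_length :: "('a, 'b) monoid_scheme \<Rightarrow> 'a set \<Rightarrow> 'a \<Rightarrow> nat" where
  "word_length G S g =
     (LEAST n. \<exists>ws. length ws = n \<and> set ws \<subseteq> S \<and> foldr (\<lambda>s t. s \<otimes>\<^bsub>G\<^esub> t) ws \<one>\<^bsub>G\<^esub> = g)"

text \<open>The normalized Haar measure of a finite group is the uniform probability measure.\<close>

definition haar_measure :: "('a, 'b) monoid_scheme \<Rightarrow> 'a measure" where
  "haar_measure G = uniform_count_measure (carrier G)"

end

theory Submission
  imports Defs
begin

text \<open>
  The semi-norm is the word-metric Lipschitz constant, the largest \<open>cmod (f (s g) - f g)\<close> with
  \<open>s \<in> S\<close>. Since \<open>f x - E f\<close> is the mean of \<open>f x - f (h x)\<close> over \<open>h\<close>, it is bounded by the mean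
  of the word length whenever \<open>f\<close> is 1-Lipschitz. The word length is itself 1-Lipschitz and
  vanishes at the identity, so there it attains the bound.
\<close>

section \<open>Essential bounds and means for the uniform counting measure\<close>

lemma measurable_uniform_count_measure:
  "f \<in> borel_measurable (uniform_count_measure A)"
  by (simp add: uniform_count_measure_def measurable_def space_point_measure sets_point_measure)

text \<open>Each point of the finite set \<open>A\<close> has mass \<open>1 / card A > 0\<close>, so
  no point can be discarded as null and conditions modulo null sets become pointwise.\<close>

lemma AE_uniform_count_measure:
  assumes "finite A"
  shows "(AE x in uniform_count_measure A. P x) \<longleftrightarrow> (\<forall>x\<in>A. P x)"
proof -
  have "0 < ennreal (1 / card A)" if "x \<in> A" for x
    using assms that by (auto simp: card_gt_0_iff)
  then show ?thesis
    unfolding uniform_count_measure_def AE_point_measure by blast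
qed

text \<open>Vector values are allowed because \<open>E_fix\<close> takes means of complex
  functions.\<close>

lemma integral_uniform_count_measure_scaleR:
  fixes f :: "'a \<Rightarrow> 'b::{banach, second_countable_topology}"
  assumes "finite A"
  shows "integral\<^sup>L (uniform_count_measure A) f = (\<Sum>x\<in>A. f x) /\<^sub>R real (card A)"
  using assms
  by (simp add: uniform_count_measure_def lebesgue_integral_point_measure_finite
      scaleR_right.sum inverse_eq_divide)

text \<open>Without null points in \<open>A\<close> the essential supremum is a plain one. The bound
  \<open>c\<close> is an \<open>ereal\<close>, so the cost itself can serve as
  \<open>c\<close>.\<close>

lemma Linf_norm_uniform_count_measure_le_iff:
  assumes "finite A"
  shows "Linf_norm (uniform_count_measure A) f \<le> c \<longleftrightarrow> (\<forall>x\<in>A. ereal (cmod (f x)) \<le> c)"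
proof
  assume *: "Linf_norm (uniform_count_measure A) f \<le> c"
  have "AE x in uniform_count_measure A.
      ereal (cmod (f x)) \<le> Linf_norm (uniform_count_measure A) f"
    unfolding Linf_norm_def by (rule esssup_AE)
  then show "\<forall>x\<in>A. ereal (cmod (f x)) \<le> c"
    using * assms by (auto simp: AE_uniform_count_measure intro: order_trans)
next
  assume "\<forall>x\<in>A. ereal (cmod (f x)) \<le> c"
  then show "Linf_norm (uniform_count_measure A) f \<le> c"
    unfolding Linf_norm_def using assms
    by (intro esssup_I measurable_uniform_count_measure) (auto simp: AE_uniform_count_measure)
qed

section \<open>Words and word length\<close>

lemma (in monoid) foldr_mult_closed:
  "set ws \<subseteq> carrier G \<Longrightarrow> foldr (\<lambda>s t. s \<otimes> t) ws \<one> \<in> carrier G"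
  by (induction ws) auto

text \<open>Folding \<open>us @ vs\<close> runs through \<open>us\<close> with the product of
  \<open>vs\<close> in place of \<open>\<one>\<close>; associativity pulls that product out.\<close>

lemma (in monoid) foldr_mult_append:
  "set us \<subseteq> carrier G \<Longrightarrow> set vs \<subseteq> carrier G \<Longrightarrow>
    foldr (\<lambda>s t. s \<otimes> t) (us @ vs) \<one> = foldr (\<lambda>s t. s \<otimes> t) us \<one> \<otimes> foldr (\<lambda>s t. s \<otimes> t) vs \<one>"
  by (induction us) (auto simp: m_assoc foldr_mult_closed simp del: foldr_append)

lemma word_length_le:
  "set ws \<subseteq> S \<Longrightarrow> foldr (\<lambda>s t. s \<otimes>\<^bsub>G\<^esub> t) ws \<one>\<^bsub>G\<^esub> = g \<Longrightarrow> word_length G S g \<le> length ws"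
  unfolding word_length_def by (rule Least_le) auto

lemma word_length_one [simp]: "word_length G S \<one>\<^bsub>G\<^esub> = 0"
  using word_length_le[of "[]" S G] by simp

context group
begin

text \<open>Words use letters of \<open>S\<close> only, while \<open>generate\<close> also admits
  inverses of generators; symmetry of \<open>S\<close> turns these into letters. Products correspond
  to concatenation.\<close>

lemma generate_imp_word:
  assumes "S \<subseteq> carrier G" and "(\<lambda>s. inv s) ` S = S" and "g \<in> generate G S"
  obtains ws where "set ws \<subseteq> S" "foldr (\<lambda>s t. s \<otimes> t) ws \<one> = g"
proof -
  from assms(3) have "\<exists>ws. set ws \<subseteq> S \<and> foldr (\<lambda>s t. s \<otimes> t) ws \<one> = g"
  proof induction
    case one
    then show ?case by (intro exI[of _ "[]"]) auto
  next
    case (incl h)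
    then show ?case using assms(1) by (intro exI[of _ "[h]"]) auto
  next
    case (inv h)
    then show ?case using assms(1,2) by (intro exI[of _ "[inv h]"]) auto
  next
    case (eng h1 h2)
    then obtain us vs where "set us \<subseteq> S" "foldr (\<lambda>s t. s \<otimes> t) us \<one> = h1"
      "set vs \<subseteq> S" "foldr (\<lambda>s t. s \<otimes> t) vs \<one> = h2" by auto
    then show ?case using assms(1) foldr_mult_append[of us vs]
      by (intro exI[of _ "us @ vs"]) auto
  qed
  with that show thesis by auto
qed

text \<open>The \<open>LEAST\<close> in \<open>word_length\<close> is attained because membership in
  \<open>generate G S\<close> supplies some word.\<close>

lemma shortest_word:
  assumes "S \<subseteq> carrier G" and "(\<lambda>s. inv s) ` S = S" and "g \<in> generate G S"
  obtains ws where "set ws \<subseteq> S" "foldr (\<lambda>s t. s \<otimes> t) ws \<one> = g" "length ws = word_length G S g"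
proof -
  obtain vs where "set vs \<subseteq> S" "foldr (\<lambda>s t. s \<otimes> t) vs \<one> = g"
    using generate_imp_word[OF assms] .
  then have "\<exists>n ws. length ws = n \<and> set ws \<subseteq> S \<and> foldr (\<lambda>s t. s \<otimes> t) ws \<one> = g"
    by auto
  from LeastI_ex[OF this] show thesis
    unfolding word_length_def[symmetric] using that by auto
qed

lemma word_length_mult_le:
  assumes "S \<subseteq> carrier G" and "(\<lambda>s. inv s) ` S = S" and "g \<in> generate G S" and "s \<in> S"
  shows "word_length G S (s \<otimes> g) \<le> word_length G S g + 1"
proof -
  obtain ws where "set ws \<subseteq> S" "foldr (\<lambda>s t. s \<otimes> t) ws \<one> = g" "length ws = word_length G S g"
    using shortest_word[OF assms(1-3)] .
  then show ?thesis
    using word_length_le[of "s # ws" S G "s \<otimes> g"] assms(4) by simp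
qed

text \<open>One direction prepends \<open>s\<close>; the other prepends \<open>inv s\<close>, a
  letter by symmetry, to return from \<open>s \<otimes> g\<close> to \<open>g\<close>.\<close>

lemma word_length_mult_diff_le:
  assumes "S \<subseteq> carrier G" and "(\<lambda>s. inv s) ` S = S" and "g \<in> generate G S" and "s \<in> S"
  shows "\<bar>real (word_length G S (s \<otimes> g)) - real (word_length G S g)\<bar> \<le> 1"
proof -
  have s: "inv s \<in> S" "s \<in> carrier G" "g \<in> carrier G"
    using assms(1,2,4) generate_in_carrier[OF assms(1,3)] by auto
  have "s \<otimes> g \<in> generate G S"
    using generate.eng[OF generate.incl[OF assms(4)] assms(3)] .
  then have "word_length G S (inv s \<otimes> (s \<otimes> g)) \<le> word_length G S (s \<otimes> g) + 1"
    using assms s by (intro word_length_mult_le)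
  moreover have "inv s \<otimes> (s \<otimes> g) = g"
    using s by (simp add: m_assoc[symmetric])
  ultimately show ?thesis
    using word_length_mult_le[OF assms] by simp
qed

text \<open>Telescoping: letters are peeled off the front, each a left multiplication costing at
  most \<open>c\<close>. The base point \<open>x\<close> stands to the right of the word, so every
  increment has the form in the hypothesis.\<close>

lemma lipschitz_along_word:
  fixes f :: "'a \<Rightarrow> complex"
  assumes "S \<subseteq> carrier G" and "\<And>s g. s \<in> S \<Longrightarrow> g \<in> carrier G \<Longrightarrow> cmod (f (s \<otimes> g) - f g) \<le> c"
    and "set ws \<subseteq> S" and "x \<in> carrier G"
  shows "cmod (f (foldr (\<lambda>s t. s \<otimes> t) ws \<one> \<otimes> x) - f x) \<le> c * length ws"
  using assms(3)
proof (induction ws)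
  case Nil
  then show ?case using assms(4) by simp
next
  case (Cons s ws)
  let ?g = "foldr (\<lambda>s t. s \<otimes> t) ws \<one>"
  have g: "?g \<in> carrier G" using Cons.prems assms(1) by (intro foldr_mult_closed) auto
  have s: "s \<in> S" "s \<in> carrier G" using Cons.prems assms(1) by auto
  have "cmod (f (s \<otimes> (?g \<otimes> x)) - f (?g \<otimes> x)) \<le> c"
    using s g assms by auto
  moreover have "cmod (f (?g \<otimes> x) - f x) \<le> c * length ws"
    using Cons by auto
  ultimately have "cmod (f (s \<otimes> (?g \<otimes> x)) - f x) \<le> c + c * length ws"
    by (rule norm_diff_triangle_le)
  then show ?case using s g assms(4) by (simp add: m_assoc algebra_simps)
qed

lemma lipschitz_word_length:
  fixes f :: "'a \<Rightarrow> complex"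
  assumes "S \<subseteq> carrier G" and "(\<lambda>s. inv s) ` S = S" and "h \<in> generate G S"
    and "\<And>s g. s \<in> S \<Longrightarrow> g \<in> carrier G \<Longrightarrow> cmod (f (s \<otimes> g) - f g) \<le> c"
    and "x \<in> carrier G"
  shows "cmod (f (h \<otimes> x) - f x) \<le> c * word_length G S h"
proof -
  obtain ws where "set ws \<subseteq> S" "foldr (\<lambda>s t. s \<otimes> t) ws \<one> = h" "length ws = word_length G S h"
    using shortest_word[OF assms(1-3)] .
  then show ?thesis
    using lipschitz_along_word[OF assms(1,4) _ assms(5), of ws] by simp
qed

end

section \<open>The word-metric Lipschitz constant as a semi-norm\<close>

text \<open>Inserting 0 makes the maximum meaningful when \<open>S\<close> is empty.\<close>

definition word_lipschitz_const ::
  "('a, 'b) monoid_scheme \<Rightarrow> 'a set \<Rightarrow> ('a \<Rightarrow> complex) \<Rightarrow> real" where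
  "word_lipschitz_const G S f =
     Max (insert 0 ((\<lambda>(s, g). cmod (f (s \<otimes>\<^bsub>G\<^esub> g) - f g)) ` (S \<times> carrier G)))"

text \<open>Taking the constant itself for \<open>c\<close> yields the pointwise bounds; other
  \<open>c\<close> reduce estimates of the maximum to pointwise ones. The conjunct
  \<open>0 \<le> c\<close> comes from the inserted 0.\<close>

lemma word_lipschitz_const_le_iff:
  assumes "finite (carrier G)" and "finite S"
  shows "word_lipschitz_const G S f \<le> c \<longleftrightarrow>
    0 \<le> c \<and> (\<forall>s\<in>S. \<forall>g\<in>carrier G. cmod (f (s \<otimes>\<^bsub>G\<^esub> g) - f g) \<le> c)"
  unfolding word_lipschitz_const_def using assms by (subst Max_le_iff) auto

lemma word_lipschitz_const_scale:
  assumes "finite (carrier G)" and "finite S"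
  shows "word_lipschitz_const G S (\<lambda>x. c * f x) = cmod c * word_lipschitz_const G S f"
proof -
  let ?A = "insert 0 ((\<lambda>(s, g). cmod (f (s \<otimes>\<^bsub>G\<^esub> g) - f g)) ` (S \<times> carrier G))"
  \<comment> \<open>Scaling by the nonnegative \<open>cmod c\<close> is monotone, so it commutes
    with the maximum; it fixes the inserted 0.\<close>
  have "cmod c * Max ?A = Max ((\<lambda>t. cmod c * t) ` ?A)"
    using assms by (intro mono_Max_commute monoI mult_left_mono) auto
  also have "(\<lambda>t. cmod c * t) ` ?A =
      insert 0 ((\<lambda>(s, g). cmod (c * f (s \<otimes>\<^bsub>G\<^esub> g) - c * f g)) ` (S \<times> carrier G))"
    by (simp add: image_image case_prod_unfold norm_mult[symmetric] right_diff_distrib)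
  finally show ?thesis
    by (simp add: word_lipschitz_const_def)
qed

lemma lipschitz_seminorm_word_lipschitz_const:
  assumes "group G" and "finite (carrier G)" and "S \<subseteq> carrier G" and "finite S"
  shows "lipschitz_seminorm (haar_measure G) (word_lipschitz_const G S)"
proof -
  interpret group G by fact
  let ?L = "word_lipschitz_const G S"
  note le_iff = word_lipschitz_const_le_iff[OF assms(2,4)]
  have bound: "0 \<le> ?L f" "s \<in> S \<Longrightarrow> g \<in> carrier G \<Longrightarrow> cmod (f (s \<otimes>\<^bsub>G\<^esub> g) - f g) \<le> ?L f" for f s g
    using le_iff[of f "?L f"] by auto
  \<comment> \<open>Agreement on the carrier suffices: \<open>S\<close> lies in the carrier, hence
    so does each \<open>s \<otimes> g\<close>.\<close>
  have cong: "?L f = ?L g" if "\<forall>x\<in>carrier G. f x = g x" for f g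
    unfolding word_lipschitz_const_def using that assms(3)
    by (intro arg_cong[of _ _ "\<lambda>A. Max (insert 0 A)"] image_cong) auto
  have add: "?L (\<lambda>x. f x + g x) \<le> ?L f + ?L g" for f g
    unfolding le_iff
  proof (intro conjI ballI)
    show "0 \<le> ?L f + ?L g" using bound by (simp add: add_nonneg_nonneg)
    fix s x assume "s \<in> S" "x \<in> carrier G"
    then have "cmod (f (s \<otimes>\<^bsub>G\<^esub> x) - f x) \<le> ?L f" "cmod (g (s \<otimes>\<^bsub>G\<^esub> x) - g x) \<le> ?L g"
      by (auto intro: bound)
    then show "cmod (f (s \<otimes>\<^bsub>G\<^esub> x) + g (s \<otimes>\<^bsub>G\<^esub> x) - (f x + g x)) \<le> ?L f + ?L g"
      using norm_diff_triangle_ineq[of "f (s \<otimes>\<^bsub>G\<^esub> x)" "g (s \<otimes>\<^bsub>G\<^esub> x)" "f x" "g x"] by linarith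
  qed
  have const: "?L (\<lambda>x. 1) = 0"
    using le_iff[of "\<lambda>x. 1" 0] bound(1)[of "\<lambda>x. 1"] by simp
  have conj: "?L (\<lambda>x. cnj (f x)) = ?L f" for f
    unfolding word_lipschitz_const_def complex_cnj_diff[symmetric] complex_mod_cnj ..
  show ?thesis
    unfolding lipschitz_seminorm_def haar_measure_def AE_uniform_count_measure[OF assms(2)]
    using bound(1) cong add const conj word_lipschitz_const_scale[OF assms(2,4)] by blast
qed

section \<open>Distance to the mean and the transportation cost\<close>

lemma (in group) lipschitz_diff_mean_le:
  fixes f :: "'a \<Rightarrow> complex"
  assumes "finite (carrier G)" and "S \<subseteq> carrier G" and "(\<lambda>s. inv s) ` S = S"
    and "generate G S = carrier G"
    and "\<And>s g. s \<in> S \<Longrightarrow> g \<in> carrier G \<Longrightarrow> cmod (f (s \<otimes> g) - f g) \<le> c"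
    and "x \<in> carrier G"
  shows "cmod ((\<Sum>g\<in>carrier G. f g) /\<^sub>R order G - f x) \<le>
    c * ((\<Sum>g\<in>carrier G. real (word_length G S g)) / order G)"
proof -
  have pos: "0 < order G" using assms(1) order_gt_0_iff_finite by blast
  \<comment> \<open>Right translation by \<open>x\<close> permutes the group. It is on the right so
    that \<open>h\<close> acts on \<open>x\<close> from the left, as the Lipschitz bound
    requires.\<close>
  have "(\<Sum>g\<in>carrier G. f g) = (\<Sum>h\<in>carrier G. f (h \<otimes> x))"
    by (rule sum.reindex_bij_witness[of _ "\<lambda>h. h \<otimes> x" "\<lambda>g. g \<otimes> inv x"])
      (use assms(6) in \<open>auto simp: m_assoc\<close>)
  then have "(\<Sum>g\<in>carrier G. f g) /\<^sub>R order G - f x =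
      (\<Sum>h\<in>carrier G. f (h \<otimes> x) - f x) /\<^sub>R order G"
    using pos by (simp add: sum_subtractf order_def[symmetric] scaleR_conv_of_real field_simps)
  also have "cmod \<dots> \<le> (\<Sum>h\<in>carrier G. c * word_length G S h) / order G"
  proof -
    have "cmod (\<Sum>h\<in>carrier G. f (h \<otimes> x) - f x) \<le> (\<Sum>h\<in>carrier G. c * word_length G S h)"
      using assms by (intro sum_norm_le lipschitz_word_length) auto
    then show ?thesis using pos by (simp add: field_simps)
  qed
  finally show ?thesis by (simp add: sum_distrib_left)
qed

theorem theorem1p2:
  fixes G :: "('a, 'b) monoid_scheme" and S :: "'a set"
  assumes "group G" and "finite (carrier G)"
    and "S \<subseteq> carrier G" and "finite S"
    and "(\<lambda>s. inv\<^bsub>G\<^esub> s) ` S = S"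
    and "generate G S = carrier G"
  shows "\<exists>L. lipschitz_seminorm (haar_measure G) L \<and>
    lipschitz_cost (haar_measure G) L (E_fix (haar_measure G)) =
      ereal (\<integral>g. real (word_length G S g) \<partial>(haar_measure G))"
proof -
  interpret group G by fact
  let ?M = "haar_measure G" and ?L = "word_lipschitz_const G S"
  let ?len = "\<lambda>g. complex_of_real (real (word_length G S g))"
  note le_iff = word_lipschitz_const_le_iff[OF assms(2,4)]
  note norm_le_iff = Linf_norm_uniform_count_measure_le_iff[OF assms(2)]
  define m where "m = (\<Sum>g\<in>carrier G. real (word_length G S g)) / order G"
  have integral: "(\<integral>g. f g \<partial>?M) = (\<Sum>g\<in>carrier G. f g) /\<^sub>R order G" for f :: "'a \<Rightarrow> complex"
    by (simp add: haar_measure_def integral_uniform_count_measure_scaleR assms(2) order_def)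
  have integral_length: "(\<integral>g. real (word_length G S g) \<partial>?M) = m"
    by (simp add: haar_measure_def integral_uniform_count_measure assms(2) order_def m_def)
  have "lipschitz_cost ?M ?L (E_fix ?M) = m"
  proof (rule antisym)
    show "lipschitz_cost ?M ?L (E_fix ?M) \<le> m"
      unfolding lipschitz_cost_def
    proof (rule SUP_least)
      fix f assume "f \<in> {f \<in> Linf ?M. Linf_selfadjoint ?M f \<and> ?L f \<le> 1}"
      then have "\<And>s g. s \<in> S \<Longrightarrow> g \<in> carrier G \<Longrightarrow> cmod (f (s \<otimes>\<^bsub>G\<^esub> g) - f g) \<le> 1"
        by (simp add: le_iff)
      \<comment> \<open>Admissibility of \<open>f\<close> is the case \<open>c = 1\<close>, where
        the bound is exactly \<open>m\<close>.\<close>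
      from lipschitz_diff_mean_le[OF assms(2,3,5,6) this]
      show "Linf_norm ?M (\<lambda>x. E_fix ?M f x - f x) \<le> m"
        by (simp add: E_fix_def integral m_def haar_measure_def[of G] norm_le_iff
            flip: integral[unfolded haar_measure_def])
    qed
  next
    \<comment> \<open>Lower bound: the word length, as a complex function, is admissible in the
      supremum.\<close>
    have "?L ?len \<le> 1"
      unfolding le_iff of_real_diff[symmetric] norm_of_real
      using word_length_mult_diff_le[OF assms(3,5)] assms(6) by simp
    moreover have "?len \<in> Linf ?M" "Linf_selfadjoint ?M ?len"
      using assms(2)
      by (auto simp: Linf_def Linf_selfadjoint_def haar_measure_def AE_uniform_count_measure
          measurable_uniform_count_measure
          intro!: exI[of _ "Max ((\<lambda>g. real (word_length G S g)) ` carrier G)"])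
    ultimately have "Linf_norm ?M (\<lambda>x. E_fix ?M ?len x - ?len x) \<le> lipschitz_cost ?M ?L (E_fix ?M)"
      unfolding lipschitz_cost_def by (intro SUP_upper) auto
    \<comment> \<open>With the cost as \<open>c\<close> in \<open>norm_le_iff\<close>, the norm
      bound may be evaluated at the single point \<open>\<one>\<close>, where the word length
      vanishes and only the mean remains.\<close>
    then have "ereal (cmod (E_fix ?M ?len \<one>\<^bsub>G\<^esub> - ?len \<one>\<^bsub>G\<^esub>)) \<le> lipschitz_cost ?M ?L (E_fix ?M)"
      unfolding haar_measure_def norm_le_iff using one_closed by blast
    moreover have "E_fix ?M ?len \<one>\<^bsub>G\<^esub> - ?len \<one>\<^bsub>G\<^esub> = complex_of_real m"
      by (simp add: E_fix_def integral m_def scaleR_conv_of_real field_simps)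
    \<comment> \<open>Nonnegativity makes \<open>cmod\<close> of the real number \<open>m\<close>
      equal to \<open>m\<close>.\<close>
    moreover have "0 \<le> m"
      by (simp add: m_def sum_nonneg)
    ultimately show "m \<le> lipschitz_cost ?M ?L (E_fix ?M)"
      by simp
  qed
  then show ?thesis
    using lipschitz_seminorm_word_lipschitz_const[OF assms(1-4)] integral_length by auto
qed

end
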